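(* Let $(\mathcal P,\succ,\prec,\alpha)$ be an admissible Hom-pre-Poisson algebra, and let $(\mathcal P^c,\diamond,\alpha)$ be its sub-adjacent admissible Hom-Poisson algebra, that is, the vector space $\mathcal P$ with $x\diamond y=x\succ y+x\prec y$. Then $(\mathcal P,L_\succ,R_\prec,\alpha)$ is a representation of $(\mathcal P^c,\diamond,\alpha)$, where $L_\succ,R_\prec:\mathcal P\to\mathrm{End}(\mathcal P)$ are defined by $L_\succ(x)y=x\succ y$, $R_\prec(x)y=y\prec x$ for all $x,y\in\mathcal P$. Conversely, if $(\mathcal P,\diamond,\alpha)$ is an admissible Hom-Poisson algebra together with two bilinear operations $\succ,\prec:\mathcal P\otimes\mathcal P\to\mathcal P$ such that $(\mathcal P,L_\succ,R_\prec,\alpha)$ is a representation of $(\mathcal P,\diamond,\alpha)$, then $(\mathcal P,\succ,\prec,\alpha)$ is an admissible Hom-pre-Poisson algebra.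
   Context: All vector spaces are finite-dimensional over a field $\mathbb F$ in which $3$ is invertible. An admissible Hom-Poisson algebra is a triple $(A,\diamond,\alpha)$ consisting of a vector space $A$, a bilinear operation $\diamond:A\otimes A\to A$ and a linear map $\alpha:A\to A$ with $\alpha(x\diamond y)=\alpha(x)\diamond\alpha(y)$ (multiplicativity, a standing assumption) such that for all $x,y,z\in A$ $$(x\diamond y)\diamond \alpha(z)=\alpha(x)\diamond(y\diamond z)-\tfrac13\big(-\alpha(x)\diamond (z\diamond y)+\alpha(z)\diamond( x\diamond y)+\alpha(y)\diamond (x\diamond z)- \alpha(y)\diamond(z\diamond x)\big).$$ A representation of $(A,\diamond,\alpha)$ is a quadruple $(V,\rho,\mu,\beta)$ with $V$ a vector space, $\beta\in\mathrm{End}(V)$ and $\rho,\mu:A\to\mathrm{End}(V)$ linear maps such that for all $x,y\in A$ (juxtaposition is composition): $$\rho(\alpha(x))\beta=\beta\rho(x),\qquad \mu(\alpha(x))\beta=\beta\mu(x),$$ $$\rho(x\diamond y)\beta=\rho(\alpha(x))\rho(y)-\tfrac13\big(-\rho(\alpha(x))\mu(y)+\mu(x\diamond y)\beta+\rho(\alpha(y))\rho(x)-\rho(\alpha(y))\mu(x)\big),$$ $$\mu(\alpha(y))\rho(x)=\rho(\alpha(x))\mu(y)-\tfrac13\big(-\rho(\alpha(x))\rho(y)+\rho(\alpha(y))\rho(x)+\mu(x\diamond y)\beta-\mu(y\diamond x)\beta\big),$$ $$\mu(\alpha(y))\mu(x)=\mu(x\diamond y)\beta-\tfrac13\big(-\mu(y\diamond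 x)\beta+\rho(\alpha(y))\mu(x)+\rho(\alpha(x))\mu(y)-\rho(\alpha(x))\rho(y)\big).$$ An admissible Hom-pre-Poisson algebra is a vector space $\mathcal P$ with two bilinear operations $\succ,\prec$ and a linear map $\alpha:\mathcal P\to\mathcal P$ which is multiplicative for both operations ($\alpha(x\succ y)=\alpha(x)\succ\alpha(y)$, $\alpha(x\prec y)=\alpha(x)\prec\alpha(y)$; standing assumption), such that for all $x,y,z\in\mathcal P$: $$-(x\succ y)\succ\alpha(z)-(x\prec y)\succ\alpha(z)+\alpha(x)\succ(y\succ z)+\tfrac13\big(\alpha(x)\succ(z\prec y)-\alpha(z)\prec(x\succ y)-\alpha(z)\prec(x\prec y)-\alpha(y)\succ(x\succ z)+\alpha(y)\succ(z\prec x)\big)=0,$$ $$-\alpha(x)\succ(z\prec y)+(x\succ z)\prec\alpha(y)+\tfrac13\big(-\alpha(x)\succ(y\succ z)+\alpha(y)\succ(x\succ z)+\alpha(z)\prec(x\prec y)+\alpha(z)\prec(x\succ y)-\alpha(z)\prec(y\succ x)-\alpha(z)\prec(y\prec x)\big)=0,$$ $$-\alpha(z)\prec(x\succ y)-\alpha(z)\prec(x\prec y)+(z\prec x)\prec\alpha(y)+\tfrac13\big(-\alpha(z)\prec(y\succ x)-\alpha(z)\prec(y\prec x)+\alpha(y)\succ(z\prec x)+\alpha(x)\succ(z\prec y)-\alpha(x)\succ(y\succ z)\big)=0.$$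
   Formalization: In the converse, the relation x⋄y = x≻y + x≺y is assumed; without it the claim fails, e.g. over the rationals on a plane with ⋄ = 0, α = id, x≻y = x₁y₂e₁, x≺y = −y₁x₂e₁. *)

theory Defs
  imports Complex_Main
begin

locale fin_dim_vector_space = vector_space scale
  for scale :: "'f::field \<Rightarrow> 'v::ab_group_add \<Rightarrow> 'v" +
  assumes fin_dim: "\<exists>Basis. finite_dimensional_vector_space scale Basis"

definition bilinear_op :: "('f::field \<Rightarrow> 'v::ab_group_add \<Rightarrow> 'v) \<Rightarrow> ('v \<Rightarrow> 'v \<Rightarrow> 'v) \<Rightarrow> bool" where
  "bilinear_op scale m \<longleftrightarrow>
     (\<forall>x. Vector_Spaces.linear scale scale (\<lambda>y. m x y)) \<and>
     (\<forall>y. Vector_Spaces.linear scale scale (\<lambda>x. m x y))"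

text \<open>In the structures below the coefficient 1/3 is only meaningful when 3 is invertible in the
  ground field (in HOL, division by 0 gives 0); this standing hypothesis on the field is stated as
  an assumption of the theorem.\<close>

locale admissible_hom_Poisson = fin_dim_vector_space scale
  for scale :: "'f::field \<Rightarrow> 'a::ab_group_add \<Rightarrow> 'a" (infixr \<open>*s\<close> 75) +
  fixes dia :: "'a \<Rightarrow> 'a \<Rightarrow> 'a" (infixl \<open>\<diamond>\<close> 80)
    and \<alpha> :: "'a \<Rightarrow> 'a"
  assumes bilinear_dia: "bilinear_op scale (\<diamond>)"
    and linear_\<alpha>: "Vector_Spaces.linear scale scale \<alpha>"
    and mult_\<alpha>: "\<alpha> (x \<diamond> y) = \<alpha> x \<diamond> \<alpha> y"
    and admissible: "(x \<diamond> y) \<diamond> \<alpha> z = \<alpha> x \<diamond> (y \<diamond> z)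
      - (1/3) *s (- (\<alpha> x \<diamond> (z \<diamond> y)) + \<alpha> z \<diamond> (x \<diamond> y) + \<alpha> y \<diamond> (x \<diamond> z) - \<alpha> y \<diamond> (z \<diamond> x))"

text \<open>The maps \<open>\<rho>, \<mu>\<close> take values in the linear endomorphisms of \<open>V\<close>. Linearity of \<open>\<rho>\<close> itself
  (with respect to the pointwise vector space structure of \<open>End(V)\<close>) is expressed by
  linearity of \<open>\<lambda>x. \<rho> x v\<close> for every \<open>v\<close>, and the identities in \<open>End(V)\<close> are
  evaluated at an arbitrary vector \<open>v\<close>.\<close>

locale admissible_hom_Poisson_rep =
  A: admissible_hom_Poisson scaleA dia \<alpha> + V: fin_dim_vector_space scaleV
  for scaleA :: "'f::field \<Rightarrow> 'a::ab_group_add \<Rightarrow> 'a"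
    and dia :: "'a \<Rightarrow> 'a \<Rightarrow> 'a" (infixl \<open>\<diamond>\<close> 80)
    and \<alpha> :: "'a \<Rightarrow> 'a"
    and scaleV :: "'f \<Rightarrow> 'v::ab_group_add \<Rightarrow> 'v" (infixr \<open>*v\<close> 75) +
  fixes \<rho> \<mu> :: "'a \<Rightarrow> 'v \<Rightarrow> 'v"
    and \<beta> :: "'v \<Rightarrow> 'v"
  assumes linear_\<beta>: "Vector_Spaces.linear scaleV scaleV \<beta>"
    and \<rho>_End: "Vector_Spaces.linear scaleV scaleV (\<rho> x)"
    and \<mu>_End: "Vector_Spaces.linear scaleV scaleV (\<mu> x)"
    and linear_\<rho>: "Vector_Spaces.linear scaleA scaleV (\<lambda>x. \<rho> x v)"
    and linear_\<mu>: "Vector_Spaces.linear scaleA scaleV (\<lambda>x. \<mu> x v)"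
    and \<rho>_\<beta>: "\<rho> (\<alpha> x) (\<beta> v) = \<beta> (\<rho> x v)"
    and \<mu>_\<beta>: "\<mu> (\<alpha> x) (\<beta> v) = \<beta> (\<mu> x v)"
    and rep1: "\<rho> (x \<diamond> y) (\<beta> v) = \<rho> (\<alpha> x) (\<rho> y v)
      - (1/3) *v (- \<rho> (\<alpha> x) (\<mu> y v) + \<mu> (x \<diamond> y) (\<beta> v) + \<rho> (\<alpha> y) (\<rho> x v) - \<rho> (\<alpha> y) (\<mu> x v))"
    and rep2: "\<mu> (\<alpha> y) (\<rho> x v) = \<rho> (\<alpha> x) (\<mu> y v)
      - (1/3) *v (- \<rho> (\<alpha> x) (\<rho> y v) + \<rho> (\<alpha> y) (\<rho> x v) + \<mu> (x \<diamond> y) (\<beta> v) - \<mu> (y \<diamond> x) (\<beta> v))"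
    and rep3: "\<mu> (\<alpha> y) (\<mu> x v) = \<mu> (x \<diamond> y) (\<beta> v)
      - (1/3) *v (- \<mu> (y \<diamond> x) (\<beta> v) + \<rho> (\<alpha> y) (\<mu> x v) + \<rho> (\<alpha> x) (\<mu> y v) - \<rho> (\<alpha> x) (\<rho> y v))"

locale admissible_hom_pre_Poisson = fin_dim_vector_space scale
  for scale :: "'f::field \<Rightarrow> 'p::ab_group_add \<Rightarrow> 'p" (infixr \<open>*s\<close> 75) +
  fixes succ :: "'p \<Rightarrow> 'p \<Rightarrow> 'p" (infixl \<open>\<succ>\<close> 80)
    and prec :: "'p \<Rightarrow> 'p \<Rightarrow> 'p" (infixl \<open>\<prec>\<close> 80)
    and \<alpha> :: "'p \<Rightarrow> 'p"
  assumes bilinear_succ: "bilinear_op scale (\<succ>)"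
    and bilinear_prec: "bilinear_op scale (\<prec>)"
    and linear_\<alpha>: "Vector_Spaces.linear scale scale \<alpha>"
    and mult_succ: "\<alpha> (x \<succ> y) = \<alpha> x \<succ> \<alpha> y"
    and mult_prec: "\<alpha> (x \<prec> y) = \<alpha> x \<prec> \<alpha> y"
    and pre1: "- ((x \<succ> y) \<succ> \<alpha> z) - (x \<prec> y) \<succ> \<alpha> z + \<alpha> x \<succ> (y \<succ> z)
      + (1/3) *s (\<alpha> x \<succ> (z \<prec> y) - \<alpha> z \<prec> (x \<succ> y) - \<alpha> z \<prec> (x \<prec> y)
                   - \<alpha> y \<succ> (x \<succ> z) + \<alpha> y \<succ> (z \<prec> x)) = 0"
    and pre2: "- (\<alpha> x \<succ> (z \<prec> y)) + (x \<succ> z) \<prec> \<alpha> y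
      + (1/3) *s (- (\<alpha> x \<succ> (y \<succ> z)) + \<alpha> y \<succ> (x \<succ> z) + \<alpha> z \<prec> (x \<prec> y)
                   + \<alpha> z \<prec> (x \<succ> y) - \<alpha> z \<prec> (y \<succ> x) - \<alpha> z \<prec> (y \<prec> x)) = 0"
    and pre3: "- (\<alpha> z \<prec> (x \<succ> y)) - \<alpha> z \<prec> (x \<prec> y) + (z \<prec> x) \<prec> \<alpha> y
      + (1/3) *s (- (\<alpha> z \<prec> (y \<succ> x)) - \<alpha> z \<prec> (y \<prec> x) + \<alpha> y \<succ> (z \<prec> x)
                   + \<alpha> x \<succ> (z \<prec> y) - \<alpha> x \<succ> (y \<succ> z)) = 0"

definition sub_adjacent :: "('p \<Rightarrow> 'p \<Rightarrow> 'p) \<Rightarrow> ('p \<Rightarrow> 'p \<Rightarrow> 'p) \<Rightarrow> 'p \<Rightarrow> 'p \<Rightarrow> 'p::plus" where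
  "sub_adjacent succ prec x y = succ x y + prec x y"

definition left_mult :: "('p \<Rightarrow> 'p \<Rightarrow> 'p) \<Rightarrow> 'p \<Rightarrow> 'p \<Rightarrow> 'p" where
  "left_mult m x y = m x y"

definition right_mult :: "('p \<Rightarrow> 'p \<Rightarrow> 'p) \<Rightarrow> 'p \<Rightarrow> 'p \<Rightarrow> 'p" where
  "right_mult m x y = m y x"

end

theory Submission
  imports Defs
begin

text \<open>
  Read at \<open>\<rho> = L\<^sub>\<succ>\<close>, \<open>\<mu> = R\<^sub>\<prec>\<close> and the vector \<open>z\<close>, the three representation identities are the three
  axioms of an admissible Hom-pre-Poisson algebra, solved for \<open>(x \<diamond> y) \<succ> \<alpha> z\<close>, \<open>(x \<succ> z) \<prec> \<alpha> y\<close> and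
  \<open>(z \<prec> x) \<prec> \<alpha> y\<close> respectively; in the same way, compatibility of \<open>\<rho>\<close> and \<open>\<mu>\<close> with \<open>\<alpha>\<close> is
  multiplicativity of \<open>\<succ>\<close> and \<open>\<prec>\<close>. Both implications of the correspondence rest on this rearrangement.

  The one computation is that \<open>\<diamond> = \<succ> + \<prec>\<close> is admissible. Split
  \<open>(x \<diamond> y) \<diamond> \<alpha> z = (x \<diamond> y) \<succ> \<alpha> z + (x \<succ> y) \<prec> \<alpha> z + (x \<prec> y) \<prec> \<alpha> z\<close> and expand each summand by the axiom
  that is solved for it. The leading terms add up to \<open>\<alpha> x \<diamond> (y \<diamond> z)\<close>, and each
  of the four terms of the admissibility correction arises by collecting one term from
  each of the three corrections, which all carry the same scalar \<open>1/3\<close>.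
\<close>

lemma bilinear_op_add:
  assumes "bilinear_op scale m"
  shows "m (x + y) z = m x z + m y z" and "m x (y + z) = m x y + m x z"
proof -
  have "module_hom scale scale (\<lambda>x. m x z)" "module_hom scale scale (m x)"
    using assms by (simp_all add: bilinear_op_def Vector_Spaces.linear.axioms(3))
  from this[THEN module_hom.add]
  show "m (x + y) z = m x z + m y z" and "m x (y + z) = m x y + m x z" .
qed

lemma bilinear_op_sub_adjacent:
  assumes "bilinear_op scale l" and "bilinear_op scale r"
  shows "bilinear_op scale (sub_adjacent l r)"
proof -
  have "vector_space_pair scale scale"
    using assms(1) by (simp add: bilinear_op_def Vector_Spaces.linear_def vector_space_pair_def)
  then interpret vector_space_pair scale scale .
  show ?thesis
    using assms by (simp add: bilinear_op_def sub_adjacent_def linear_compose_add)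
qed

context admissible_hom_pre_Poisson
begin

abbreviation sub_adjacent_op (infixl \<open>\<diamond>\<close> 80) where
  "x \<diamond> y \<equiv> sub_adjacent (\<succ>) (\<prec>) x y"

lemmas succ_add = bilinear_op_add[OF bilinear_succ]
lemmas prec_add = bilinear_op_add[OF bilinear_prec]

text \<open>The twisted right factor \<open>\<alpha> z\<close> or \<open>\<alpha> y\<close> occurs in one product only of each axiom, once \<open>\<succ> + \<prec>\<close> is
  written as \<open>\<diamond>\<close>. Solving for that product gives rewrite rules that together expand any
  \<open>(_ \<diamond> _) \<diamond> \<alpha> _\<close>; they are also the representation identities for \<open>L\<^sub>\<succ>\<close> and \<open>R\<^sub>\<prec>\<close>.\<close>

lemma sub_adjacent_succ_twist:
  "(x \<diamond> y) \<succ> \<alpha> z = \<alpha> x \<succ> (y \<succ> z)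
     - (1/3) *s (- (\<alpha> x \<succ> (z \<prec> y)) + \<alpha> z \<prec> (x \<diamond> y) + \<alpha> y \<succ> (x \<succ> z) - \<alpha> y \<succ> (z \<prec> x))"
  using pre1[of x y z]
  by (simp add: sub_adjacent_def succ_add prec_add algebra_simps)

lemma succ_prec_twist:
  "(x \<succ> z) \<prec> \<alpha> y = \<alpha> x \<succ> (z \<prec> y)
     - (1/3) *s (- (\<alpha> x \<succ> (y \<succ> z)) + \<alpha> y \<succ> (x \<succ> z) + \<alpha> z \<prec> (x \<diamond> y) - \<alpha> z \<prec> (y \<diamond> x))"
  using pre2[of x z y]
  by (simp add: sub_adjacent_def succ_add prec_add algebra_simps)

lemma prec_prec_twist:
  "(z \<prec> x) \<prec> \<alpha> y = \<alpha> z \<prec> (x \<diamond> y)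
     - (1/3) *s (- (\<alpha> z \<prec> (y \<diamond> x)) + \<alpha> y \<succ> (z \<prec> x) + \<alpha> x \<succ> (z \<prec> y) - \<alpha> x \<succ> (y \<succ> z))"
  using pre3[of z x y]
  by (simp add: sub_adjacent_def succ_add prec_add algebra_simps)

lemma sub_adjacent_admissible:
  "(x \<diamond> y) \<diamond> \<alpha> z = \<alpha> x \<diamond> (y \<diamond> z)
     - (1/3) *s (- (\<alpha> x \<diamond> (z \<diamond> y)) + \<alpha> z \<diamond> (x \<diamond> y) + \<alpha> y \<diamond> (x \<diamond> z) - \<alpha> y \<diamond> (z \<diamond> x))"
proof -
  have "(x \<diamond> y) \<diamond> \<alpha> z = (x \<diamond> y) \<succ> \<alpha> z + ((x \<succ> y) \<prec> \<alpha> z + (x \<prec> y) \<prec> \<alpha> z)"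
    by (simp add: sub_adjacent_def prec_add)
  then show ?thesis
    unfolding sub_adjacent_succ_twist succ_prec_twist prec_prec_twist
    by (simp add: sub_adjacent_def succ_add prec_add algebra_simps)
qed

lemma sub_adjacent_hom_Poisson: "admissible_hom_Poisson scale (\<diamond>) \<alpha>"
proof -
  interpret \<alpha>: Vector_Spaces.linear scale scale \<alpha>
    by (fact linear_\<alpha>)
  show ?thesis
  proof
    show "bilinear_op scale (\<diamond>)"
      by (rule bilinear_op_sub_adjacent[OF bilinear_succ bilinear_prec])
    show "\<alpha> (x \<diamond> y) = \<alpha> x \<diamond> \<alpha> y" for x y
      by (simp add: sub_adjacent_def mult_succ mult_prec \<alpha>.add)
  qed (fact sub_adjacent_admissible)
qed

lemma left_right_mult_representation:
  "admissible_hom_Poisson_rep scale (\<diamond>) \<alpha> scale (left_mult (\<succ>)) (right_mult (\<prec>)) \<alpha>"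
proof -
  have linear: "Vector_Spaces.linear scale scale ((\<succ>) x)"
    "Vector_Spaces.linear scale scale (\<lambda>z. z \<prec> x)"
    "Vector_Spaces.linear scale scale (\<lambda>z. z \<succ> x)"
    "Vector_Spaces.linear scale scale ((\<prec>) x)" for x
    using bilinear_succ bilinear_prec by (simp_all add: bilinear_op_def)
  show ?thesis
    unfolding left_mult_def[abs_def] right_mult_def[abs_def]
    by (intro admissible_hom_Poisson_rep.intro admissible_hom_Poisson_rep_axioms.intro)
      (fact sub_adjacent_hom_Poisson fin_dim_vector_space_axioms linear_\<alpha> linear
        mult_succ[symmetric] mult_prec[symmetric]
        sub_adjacent_succ_twist succ_prec_twist prec_prec_twist)+
qed

end

text \<open>Multiplicativity of \<open>\<prec>\<close> is compatibility of \<open>R\<^sub>\<prec>\<close> with \<open>\<alpha>\<close> at interchanged arguments, because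
  \<open>R\<^sub>\<prec>\<close> acts by its right factor; otherwise the axioms and identities match one to one.\<close>

lemma hom_pre_Poisson_of_representation:
  assumes succ: "bilinear_op scale succ" and prec: "bilinear_op scale prec"
    and rep: "admissible_hom_Poisson_rep scale (sub_adjacent succ prec) \<alpha>
      scale (left_mult succ) (right_mult prec) \<alpha>"
  shows "admissible_hom_pre_Poisson scale succ prec \<alpha>"
proof -
  interpret admissible_hom_Poisson_rep scale "sub_adjacent succ prec" \<alpha>
    scale "left_mult succ" "right_mult prec" \<alpha>
    by (fact rep)
  interpret \<alpha>: Vector_Spaces.linear scale scale \<alpha>
    by (fact linear_\<beta>)
  note add = bilinear_op_add[OF succ] bilinear_op_add[OF prec]
  note mult_defs = left_mult_def right_mult_def sub_adjacent_def
  note expand = add algebra_simps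
  show ?thesis
  proof
    show "\<alpha> (succ x y) = succ (\<alpha> x) (\<alpha> y)" "\<alpha> (prec x y) = prec (\<alpha> x) (\<alpha> y)" for x y
      using \<rho>_\<beta>[of x y] \<mu>_\<beta>[of y x] by (simp_all add: mult_defs)
  next
    fix x y z
    show "- succ (succ x y) (\<alpha> z) - succ (prec x y) (\<alpha> z) + succ (\<alpha> x) (succ y z)
        + scale (1/3) (succ (\<alpha> x) (prec z y) - prec (\<alpha> z) (succ x y) - prec (\<alpha> z) (prec x y)
            - succ (\<alpha> y) (succ x z) + succ (\<alpha> y) (prec z x)) = 0"
      using rep1[of x y z] unfolding mult_defs by (simp add: expand)
  next
    fix x y z
    show "- succ (\<alpha> x) (prec z y) + prec (succ x z) (\<alpha> y)
        + scale (1/3) (- succ (\<alpha> x) (succ y z) + succ (\<alpha> y) (succ x z) + prec (\<alpha> z) (prec x y)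
            + prec (\<alpha> z) (succ x y) - prec (\<alpha> z) (succ y x) - prec (\<alpha> z) (prec y x)) = 0"
      \<comment> \<open>here and below the outer action, by \<open>\<alpha> y\<close>, comes first in the order of the variables\<close>
      using rep2[of y x z] unfolding mult_defs by (simp add: expand)
  next
    fix x y z
    show "- prec (\<alpha> z) (succ x y) - prec (\<alpha> z) (prec x y) + prec (prec z x) (\<alpha> y)
        + scale (1/3) (- prec (\<alpha> z) (succ y x) - prec (\<alpha> z) (prec y x) + succ (\<alpha> y) (prec z x)
            + succ (\<alpha> x) (prec z y) - succ (\<alpha> x) (succ y z)) = 0"
      using rep3[of y x z] unfolding mult_defs by (simp add: expand)
  qed (fact succ prec)+
qed

theorem proposition6p6:
  fixes scale :: "'f::field \<Rightarrow> 'p::ab_group_add \<Rightarrow> 'p"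
    and succ prec :: "'p \<Rightarrow> 'p \<Rightarrow> 'p"
    and \<alpha> :: "'p \<Rightarrow> 'p"
  assumes three_invertible: "(3::'f) \<noteq> 0"
  shows "(admissible_hom_pre_Poisson scale succ prec \<alpha> \<longrightarrow>
            admissible_hom_Poisson scale (sub_adjacent succ prec) \<alpha> \<and>
            admissible_hom_Poisson_rep scale (sub_adjacent succ prec) \<alpha>
              scale (left_mult succ) (right_mult prec) \<alpha>) \<and>
         (\<forall>dia. admissible_hom_Poisson scale dia \<alpha> \<and>
            bilinear_op scale succ \<and> bilinear_op scale prec \<and>
            dia = sub_adjacent succ prec \<and>
            admissible_hom_Poisson_rep scale dia \<alpha>
              scale (left_mult succ) (right_mult prec) \<alpha> \<longrightarrow>
            admissible_hom_pre_Poisson scale succ prec \<alpha>)"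
  using admissible_hom_pre_Poisson.sub_adjacent_hom_Poisson
    admissible_hom_pre_Poisson.left_right_mult_representation
    hom_pre_Poisson_of_representation
  by metis

end
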